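(* Let $R$ be a commutative ring with unit, let $n\ge1$, and let $u_1,\dots,u_n\in tR[[t]]$. Let $Q(x,t)\in R((x))((t))$ contain only nonnegative powers of $x$. Then, in $R((x))((t))$, $$\mathop{\mathrm{PT}}_x\ Q(x,t)\prod_{i=1}^n\frac{1}{x-u_i}=\partial_{u_n}\partial_{u_{n-1}}\cdots\partial_{u_1}Q(x,t).$$ In particular, $$\mathop{\mathrm{CT}}_x\ xQ(x,t)\prod_{i=1}^n\frac1{x-u_i}=\sum_{i=1}^nQ(u_i,t)\prod_{1\le j\le n,\ j\ne i}\frac1{u_i-u_j}.$$
   Context: $R((x))((t))$ is the ring of Laurent series in $t$ with coefficients in the ring $R((x))$ of Laurent series in $x$. For $f=\sum_{n\ge n_0}\sum_{m}a_{mn}x^mt^n$ in it, $\mathrm{PT}_xf=\sum_{n\ge n_0}\sum_{m\ge0}a_{mn}x^mt^n$ and $\mathrm{CT}_xf=\sum_{n\ge n_0}a_{0n}t^n$. For $u\in tR[[t]]$, $\frac1{x-u}=x^{-1}\sum_{k\ge0}u^kx^{-k}$. The divided difference operator (with respect to $x$) is $\partial_uf(x)=\frac{f(x)-f(u)}{x-u}$, i.e. the linear operator with $\partial_ux^m=\sum_{k=0}^{m-1}x^{m-1-k}u^k$ for $m\ge0$ (applied coefficientwise in $t$). The $u_i$ are allowed to be zero and to coincide; the right-hand side of the second formula is understood as follows: for indeterminates $z_1,\dots,z_n$ the expression $\sum_iQ(z_i,t)\prod_{j\ne i}(z_i-z_j)^{-1}$ is a series in nonnegative powers of the $z_i$ (with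 coefficients Laurent in $t$), and one substitutes $z_i=u_i$. *)

theory Defs
  imports
    "HOL-Computational_Algebra.Formal_Laurent_Series"
    "HOL-Library.Multiset"
begin

text \<open>
  The ring of Laurent series in \<open>t\<close> over the ring of Laurent series in \<open>x\<close> is \<open>'a fls fls\<close>:
  the outer index is the exponent of \<open>t\<close>, the inner one the exponent of \<open>x\<close>. So
  \<open>f $$ k $$ m\<close> is the coefficient of \<open>x\<^sup>m t\<^sup>k\<close>. Laurent series in \<open>t\<close> alone are \<open>'a fls\<close>,
  power series in \<open>t\<close> alone are \<open>'a fps\<close>.
\<close>

unbundle fps_syntax

section \<open>Coefficientwise operations\<close>

text \<open>Only meaningful for \<open>h 0 = 0\<close>, which holds in all uses.\<close>

definition fls_map :: "('a::zero \<Rightarrow> 'b::zero) \<Rightarrow> 'a fls \<Rightarrow> 'b fls" where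
  "fls_map h f = Abs_fls (\<lambda>k. h (f $$ k))"

lemma fls_map_nth [simp]:
  assumes "h 0 = 0"
  shows "fls_map h f $$ k = h (f $$ k)"
  unfolding fls_map_def
  by (rule nth_Abs_fls_lower_bound[of "fls_subdegree f"]) (simp add: assms)

text \<open>
  The series \<open>\<Sum>\<^sub>k h (f\<^sub>k) t\<^sup>k\<close> for \<open>f = \<Sum>\<^sub>k f\<^sub>k t\<^sup>k\<close>, where each \<open>h (f\<^sub>k)\<close> is itself a power series in \<open>t\<close>.
\<close>

definition fls_extend :: "('b::zero \<Rightarrow> 'a::comm_monoid_add fps) \<Rightarrow> 'b fls \<Rightarrow> 'a fls" where
  "fls_extend h f = Abs_fls (\<lambda>q. \<Sum>k = fls_subdegree f..q. h (f $$ k) $ nat (q - k))"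

lemma fls_extend_nth:
  "fls_extend h f $$ q = (\<Sum>k = fls_subdegree f..q. h (f $$ k) $ nat (q - k))"
  unfolding fls_extend_def
  by (rule nth_Abs_fls_lower_bound[of "fls_subdegree f"]) simp


section \<open>Positive and constant part with respect to \<open>x\<close>\<close>

definition PT :: "'a::comm_ring_1 fls fls \<Rightarrow> 'a fls fls" where
  "PT = fls_map (\<lambda>g. fps_to_fls (fls_regpart g))"

definition CT :: "'a::comm_ring_1 fls fls \<Rightarrow> 'a fls fls" where
  "CT = fls_map (\<lambda>g. fls_const (g $$ 0))"

lemma PT_nth: "PT f $$ k $$ m = (if m \<ge> 0 then f $$ k $$ m else 0)"
  by (simp add: PT_def)

lemma CT_nth: "CT f $$ k $$ m = (if m = 0 then f $$ k $$ 0 else 0)"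
  by (simp add: CT_def)

definition nonneg_powers_x :: "'a::zero fls fls \<Rightarrow> bool" where
  "nonneg_powers_x f \<longleftrightarrow> (\<forall>k m. m < 0 \<longrightarrow> f $$ k $$ m = 0)"


section \<open>The elements \<open>x\<close>, \<open>u\<close> and \<open>1 / (x - u)\<close>\<close>

text \<open>Series in \<open>t\<close> as series in \<open>x\<close> and \<open>t\<close> that are constant in \<open>x\<close>.\<close>

definition const_x :: "'a::comm_ring_1 fls \<Rightarrow> 'a fls fls" where
  "const_x = fls_map fls_const"

lemma const_x_nth: "const_x f $$ k = fls_const (f $$ k)"
  by (simp add: const_x_def)

definition var_x :: "'a::comm_ring_1 fls fls" where
  "var_x = fls_const fls_X"

text \<open>
  \<open>1 / (x - u) = x\<^sup>-\<^sup>1 \<Sum>\<^sub>k (u x\<^sup>-\<^sup>1)\<^sup>k\<close>; the sum over \<open>k\<close> is the composition of the geometric series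
  with the power series \<open>u x\<^sup>-\<^sup>1\<close> in \<open>t\<close>, whose constant term vanishes.
\<close>

definition inv_x_minus :: "'a::comm_ring_1 fps \<Rightarrow> 'a fls fls" where
  "inv_x_minus u =
     fls_const fls_X_inv *
     fps_to_fls (Abs_fps (\<lambda>_. 1) oo Abs_fps (\<lambda>j. fls_const (u $ j) * fls_X_inv))"

lemma geometric_compose:
  fixes V :: "'b::comm_ring_1 fps"
  assumes "V $ 0 = 0"
  shows "(1 - V) * (Abs_fps (\<lambda>_. 1) oo V) = 1"
proof (rule fps_ext)
  fix N
  let ?S = "Abs_fps (\<lambda>_. 1) oo V" and ?T = "\<Sum>k\<le>N. V ^ k"
  have V: "(V ^ k) $ i = 0" if "i < k" for i k
    using assms that by (simp add: startsby_zero_power_prefix)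
  have eq: "?S $ i = ?T $ i" if "i \<le> N" for i
  proof -
    have "?S $ i = (\<Sum>k\<le>i. (V ^ k) $ i)"
      by (simp add: fps_compose_nth atLeast0AtMost)
    also have "\<dots> = (\<Sum>k\<le>N. (V ^ k) $ i)"
      by (rule sum.mono_neutral_left) (use that V in auto)
    finally show ?thesis by (simp add: fps_sum_nth)
  qed
  have "((1 - V) * ?S) $ N = ((1 - V) * ?T) $ N"
    unfolding fps_mult_nth by (rule sum.cong) (auto simp: eq)
  also have "(1 - V) * ?T = 1 - V ^ Suc N"
    using sum_gp_basic[of V N] by simp
  also have "\<dots> $ N = 1 $ N"
    using V[of N "Suc N"] by simp
  finally show "((1 - V) * ?S) $ N = 1 $ N" .
qed

lemma x_minus_mult_inv:
  fixes u :: "'a::comm_ring_1 fps"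
  assumes "u $ 0 = 0"
  shows "(var_x - const_x (fps_to_fls u)) * inv_x_minus u = 1"
proof -
  define V where "V = Abs_fps (\<lambda>j. fls_const (u $ j) * (fls_X_inv :: 'a fls))"
  have X: "fls_const fls_X * fls_const fls_X_inv = (1 :: 'a fls fls)"
    by (simp add: fls_X_times_conv_shift)
  have "const_x (fps_to_fls u) * fls_const fls_X_inv = fps_to_fls V"
    by (rule fls_eqI) (simp add: const_x_nth V_def)
  with X have "(var_x - const_x (fps_to_fls u)) * fls_const fls_X_inv = fps_to_fls (1 - V)"
    by (simp add: var_x_def left_diff_distrib fps_to_fls_minus)
  hence "(var_x - const_x (fps_to_fls u)) * inv_x_minus u
      = fps_to_fls ((1 - V) * (Abs_fps (\<lambda>_. 1) oo V))"
    by (simp add: inv_x_minus_def V_def fls_times_fps_to_fls mult.assoc[symmetric])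
  also have "\<dots> = 1"
    using assms by (subst geometric_compose) (simp_all add: V_def)
  finally show ?thesis .
qed


section \<open>Divided differences\<close>

text \<open>\<open>f(u)\<close>, for \<open>f\<close> with only nonnegative powers of \<open>x\<close> and \<open>u\<close> without constant term.\<close>

definition eval_x :: "'a::comm_ring_1 fls fls \<Rightarrow> 'a fps \<Rightarrow> 'a fls" where
  "eval_x f u = fls_extend (\<lambda>g. fls_regpart g oo u) f"

definition divdiff :: "'a::comm_ring_1 fps \<Rightarrow> 'a fls fls \<Rightarrow> 'a fls fls" where
  "divdiff u f = (f - const_x (eval_x f u)) * inv_x_minus u"

lemma x_minus_mult_divdiff:
  assumes "u $ 0 = 0"
  shows "(var_x - const_x (fps_to_fls u)) * divdiff u f = f - const_x (eval_x f u)"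
  by (simp only: divdiff_def mult.left_commute[of _ "f - _"] x_minus_mult_inv[OF assms] mult_1_right)

lemma eval_x_power:
  fixes u :: "'a::comm_ring_1 fps"
  assumes "u $ 0 = 0"
  shows "eval_x (var_x ^ m) u = fps_to_fls u ^ m"
proof -
  have pow: "var_x ^ m = (fls_const (fls_X ^ m) :: 'a fls fls)"
    by (induction m) (simp_all add: var_x_def)
  have reg: "fls_regpart (fls_X ^ m :: 'a fls) = fps_X ^ m"
    by (rule fps_ext) (simp add: fps_X_power_iff)
  have comp: "fps_X ^ m oo u = u ^ m"
    using assms by (simp add: fps_eq_iff fps_compose_nth fps_X_power_iff mult_delta_left
        startsby_zero_power_prefix)
  have "eval_x (var_x ^ m) u = fps_to_fls (fps_X ^ m oo u)"
    unfolding eval_x_def pow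
  proof (rule fls_eqI)
    fix q :: int
    let ?g = "\<lambda>g. fls_regpart g oo u" and ?f = "fls_const (fls_X ^ m :: 'a fls)"
    have "fls_extend ?g ?f $$ q = (\<Sum>k = 0..q. if k = 0 then (fps_X ^ m oo u) $ nat q else 0)"
      unfolding fls_extend_nth fls_const_subdegree by (rule sum.cong) (simp_all add: reg)
    thus "fls_extend ?g ?f $$ q = fps_to_fls (fps_X ^ m oo u) $$ q"
      by simp
  qed
  thus ?thesis
    by (simp only: comp fps_to_fls_power)
qed

lemma const_x_power:
  fixes u :: "'a::comm_ring_1 fps"
  shows "const_x (fps_to_fls (u ^ k)) = const_x (fps_to_fls u) ^ k"
proof -
  define c :: "'a fps \<Rightarrow> 'a fls fps" where "c v = Abs_fps (\<lambda>j. fls_const (v $ j))" for v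
  have c: "const_x (fps_to_fls v) = fps_to_fls (c v)" for v
    by (rule fls_eqI) (simp add: const_x_nth c_def)
  have sum: "fls_const (\<Sum>i\<in>A. h i) = (\<Sum>i\<in>A. fls_const (h i))" if "finite A"
    for A :: "nat set" and h :: "nat \<Rightarrow> 'a"
    using that by (induction A) (simp_all add: fls_plus_const[symmetric])
  have "c (v * w) = c v * c w" for v w
    by (rule fps_ext) (simp add: c_def fps_mult_nth sum)
  moreover have "c 1 = 1"
    by (rule fps_ext) (simp add: c_def)
  ultimately have "c (u ^ k) = c u ^ k"
    by (induction k) simp_all
  thus ?thesis
    by (simp only: c fps_to_fls_power[symmetric])
qed

lemma divdiff_power:
  fixes u :: "'a::comm_ring_1 fps"
  assumes "u $ 0 = 0"
  shows "divdiff u (var_x ^ m) =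
    (\<Sum>k<m. var_x ^ (m - 1 - k) * const_x (fps_to_fls (u ^ k)))"
proof -
  let ?U = "const_x (fps_to_fls u)"
  have U: "const_x (fps_to_fls (u ^ k)) = ?U ^ k" for k
    by (rule const_x_power)
  define D where "D = (\<Sum>k<m. var_x ^ (m - 1 - k) * ?U ^ k)"
  have "?U ^ m - var_x ^ m = (?U - var_x) * D"
    unfolding D_def by (simp add: power_diff_sumr2)
  hence "var_x ^ m - ?U ^ m = (var_x - ?U) * D"
    by (simp add: left_diff_distrib) (simp add: algebra_simps)
  hence "divdiff u (var_x ^ m) = (var_x - ?U) * D * inv_x_minus u"
    by (simp only: divdiff_def eval_x_power[OF assms] U flip: fps_to_fls_power)
  also have "\<dots> = D * ((var_x - ?U) * inv_x_minus u)"
    by (simp only: mult_ac)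
  also have "\<dots> = D"
    by (simp only: x_minus_mult_inv[OF assms] mult_1_right)
  finally show ?thesis
    by (simp only: D_def U)
qed


section \<open>Power series in the indeterminates \<open>z\<^sub>i\<close>\<close>

text \<open>
  A monomial in \<open>z\<^sub>0, z\<^sub>1, \<dots>\<close> is given by the multiset of its indeterminates, so that
  the product of monomials is the sum of multisets and the degree is the size.
\<close>

typedef 'a mfps = "UNIV :: (nat multiset \<Rightarrow> 'a) set"
  morphisms mfps_nth Abs_mfps ..

setup_lifting type_definition_mfps

lemma mfps_eqI: "(\<And>M. mfps_nth f M = mfps_nth g M) \<Longrightarrow> f = g"
  by (metis mfps_nth_inject ext)

lemma finite_monomials:
  assumes "finite S"
  shows "finite {M. set_mset M \<subseteq> S \<and> size M \<le> d}"
proof -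
  have "{M. set_mset M \<subseteq> S \<and> size M \<le> d} \<subseteq> mset ` {xs. set xs \<subseteq> S \<and> length xs \<le> d}"
  proof
    fix M assume "M \<in> {M. set_mset M \<subseteq> S \<and> size M \<le> d}"
    moreover obtain xs where "M = mset xs" by (metis ex_mset)
    ultimately show "M \<in> mset ` {xs. set xs \<subseteq> S \<and> length xs \<le> d}" by auto
  qed
  thus ?thesis
    by (rule finite_subset) (intro finite_imageI finite_lists_length_le assms)
qed

lemma finite_submultisets: "finite {A. A \<subseteq># M}"
  by (rule finite_subset[OF _ finite_monomials[of "set_mset M" "size M"]])
     (auto dest: mset_subset_eqD size_mset_mono)

instantiation mfps :: (comm_ring_1) comm_ring_1
begin

lift_definition zero_mfps :: "'a mfps" is "\<lambda>_. 0" .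
lift_definition one_mfps :: "'a mfps" is "\<lambda>M. if M = {#} then 1 else 0" .
lift_definition plus_mfps :: "'a mfps \<Rightarrow> 'a mfps \<Rightarrow> 'a mfps" is "\<lambda>f g M. f M + g M" .
lift_definition minus_mfps :: "'a mfps \<Rightarrow> 'a mfps \<Rightarrow> 'a mfps" is "\<lambda>f g M. f M - g M" .
lift_definition uminus_mfps :: "'a mfps \<Rightarrow> 'a mfps" is "\<lambda>f M. - f M" .
lift_definition times_mfps :: "'a mfps \<Rightarrow> 'a mfps \<Rightarrow> 'a mfps" is
  "\<lambda>f g M. \<Sum>A | A \<subseteq># M. f A * g (M - A)" .

instance
proof
  fix f g h :: "'a mfps"
  show "f * g * h = f * (g * h)"
  proof (rule mfps_eqI)
    fix M :: "nat multiset"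
    have sub1: "A - B \<subseteq># M - B" if "A \<subseteq># M" for A B
      using that by (simp add: subseteq_mset_def diff_le_mono)
    have sub2: "A + B \<subseteq># M" if "A \<subseteq># M" "B \<subseteq># M - A" for A B
      using that by (metis subset_mset.add_diff_inverse subset_mset.add_left_mono)
    have "mfps_nth (f * g * h) M =
        (\<Sum>(A, B)\<in>(SIGMA A:{A. A \<subseteq># M}. {B. B \<subseteq># A}).
           mfps_nth f B * mfps_nth g (A - B) * mfps_nth h (M - A))"
      by (simp add: times_mfps.rep_eq sum_distrib_right sum.Sigma finite_submultisets)
    also have "\<dots> =
        (\<Sum>(A, B)\<in>(SIGMA A:{A. A \<subseteq># M}. {B. B \<subseteq># M - A}).
           mfps_nth f A * (mfps_nth g B * mfps_nth h (M - A - B)))"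
      by (rule sum.reindex_bij_witness
            [where i = "\<lambda>(A, B). (A + B, A)" and j = "\<lambda>(A, B). (B, A - B)"])
         (auto simp: mult.assoc sub1 sub2 intro: subset_mset.order_trans)
    also have "\<dots> = mfps_nth (f * (g * h)) M"
      by (simp add: times_mfps.rep_eq sum_distrib_left sum.Sigma finite_submultisets)
    finally show "mfps_nth (f * g * h) M = mfps_nth (f * (g * h)) M" .
  qed
  show "f * g = g * f"
  proof (rule mfps_eqI)
    fix M :: "nat multiset"
    show "mfps_nth (f * g) M = mfps_nth (g * f) M"
      unfolding times_mfps.rep_eq
      by (rule sum.reindex_bij_witness[where i = "\<lambda>A. M - A" and j = "\<lambda>A. M - A"])
         (auto simp: subset_mset.diff_diff_right mult.commute)
  qed
  show "1 * f = f"
  proof (rule mfps_eqI)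
    fix M :: "nat multiset"
    have "mfps_nth (1 * f) M = (\<Sum>A | A \<subseteq># M. if A = {#} then mfps_nth f M else 0)"
      unfolding times_mfps.rep_eq one_mfps.rep_eq by (rule sum.cong) auto
    thus "mfps_nth (1 * f) M = mfps_nth f M"
      by (simp add: finite_submultisets)
  qed
  show "(f + g) * h = f * h + g * h"
    by (rule mfps_eqI)
       (simp add: times_mfps.rep_eq plus_mfps.rep_eq distrib_right sum.distrib)
  show "(0::'a mfps) \<noteq> 1"
    by (metis one_mfps.rep_eq zero_mfps.rep_eq zero_neq_one)
qed (rule mfps_eqI; simp add: plus_mfps.rep_eq minus_mfps.rep_eq uminus_mfps.rep_eq
       zero_mfps.rep_eq)+

end

lift_definition mfps_var :: "nat \<Rightarrow> 'a::comm_ring_1 mfps" is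
  "\<lambda>i M. if M = {#i#} then 1 else 0" .

text \<open>The power series \<open>g(z\<^sub>i)\<close>; the monomials in \<open>z\<^sub>i\<close> alone are the multisets \<open>replicate_mset m i\<close>.\<close>

lift_definition mfps_of_fps :: "nat \<Rightarrow> 'a::comm_ring_1 fps \<Rightarrow> 'a mfps" is
  "\<lambda>i g M. if M = replicate_mset (size M) i then g $ size M else 0" .

text \<open>
  Substitution of \<open>u\<^sub>i\<close> for \<open>z\<^sub>i\<close> in a power series in \<open>z\<^sub>1, \<dots>, z\<^sub>n\<close>. As the \<open>u\<^sub>i\<close> have no constant
  term, monomials of degree greater than \<open>d\<close> do not contribute to the coefficient of \<open>t\<^sup>d\<close>.
\<close>

definition mfps_subst :: "nat \<Rightarrow> (nat \<Rightarrow> 'a::comm_ring_1 fps) \<Rightarrow> 'a mfps \<Rightarrow> 'a fps" where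
  "mfps_subst n u G = Abs_fps (\<lambda>d.
     \<Sum>M | set_mset M \<subseteq> {1..n} \<and> size M \<le> d. mfps_nth G M * (\<Prod>i\<in>#M. u i) $ d)"

section \<open>The sum \<open>\<Sum>\<^sub>i Q(z\<^sub>i,t) \<Prod>\<^sub>j\<^sub>\<noteq>\<^sub>i 1 / (z\<^sub>i - z\<^sub>j)\<close>\<close>

definition var_z :: "nat \<Rightarrow> 'a::comm_ring_1 mfps fls" where
  "var_z i = fls_const (mfps_var i)"

definition at_z :: "'a::comm_ring_1 fls fls \<Rightarrow> nat \<Rightarrow> 'a mfps fls" where
  "at_z Q i = fls_map (\<lambda>g. mfps_of_fps i (fls_regpart g)) Q"

definition denom_z :: "nat \<Rightarrow> nat \<Rightarrow> 'a::comm_ring_1 mfps fls" where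
  "denom_z n i = (\<Prod>j\<in>{1..n} - {i}. var_z i - var_z j)"

text \<open>
  \<open>S = \<Sum>\<^sub>i Q(z\<^sub>i,t) / denom_z n i\<close> as an identity of fractions, brought to the common
  denominator \<open>\<Prod>\<^sub>k denom_z n k\<close>, which is not a zero divisor.
\<close>

definition is_fraction_sum :: "nat \<Rightarrow> 'a::comm_ring_1 fls fls \<Rightarrow> 'a mfps fls \<Rightarrow> bool" where
  "is_fraction_sum n Q S \<longleftrightarrow>
     (\<forall>k M. \<not> set_mset M \<subseteq> {1..n} \<longrightarrow> mfps_nth (S $$ k) M = 0) \<and>
     S * (\<Prod>k\<in>{1..n}. denom_z n k) =
       (\<Sum>i\<in>{1..n}. at_z Q i * (\<Prod>k\<in>{1..n} - {i}. denom_z n k))"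

lemma mfps_var_times_nth:
  "mfps_nth (mfps_var i * f) N = (if i \<in># N then mfps_nth f (N - {#i#}) else 0)"
proof -
  have "mfps_nth (mfps_var i * f) N =
      (\<Sum>A | A \<subseteq># N. if A = {#i#} then mfps_nth f (N - {#i#}) else 0)"
    unfolding times_mfps.rep_eq mfps_var.rep_eq by (rule sum.cong) auto
  thus ?thesis
    by (simp add: finite_submultisets)
qed

lemma mfps_var_diff_cancel:
  assumes "i \<noteq> j" and "(mfps_var i - mfps_var j) * f = 0"
  shows "f = 0"
proof -
  have eq: "mfps_nth (mfps_var i * f) N = mfps_nth (mfps_var j * f) N" for N
    using assms(2) by (simp add: left_diff_distrib)
  have "mfps_nth f M = 0" for M
  proof (induction "count M j" arbitrary: M rule: less_induct)
    case less
    show ?case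
    proof (cases "j \<in># M")
      case True
      hence "mfps_nth f (add_mset i M - {#j#}) = 0"
        using assms(1) by (intro less) simp
      with eq[of "add_mset i M"] show ?thesis
        by (simp add: mfps_var_times_nth)
    next
      case False
      with eq[of "add_mset i M"] assms(1) show ?thesis
        by (simp add: mfps_var_times_nth)
    qed
  qed
  thus ?thesis
    by (intro mfps_eqI) (simp add: zero_mfps.rep_eq)
qed

lemma denom_z_prod_cancel:
  assumes "(\<Prod>k\<in>{1..n}. denom_z n k) * S = 0"
  shows "S = 0"
proof -
  have var: "T = 0" if "i \<noteq> j" "(var_z i - var_z j) * T = 0" for i j and T :: "'a mfps fls"
  proof (rule fls_eqI)
    fix k
    have "(mfps_var i - mfps_var j) * T $$ k = ((var_z i - var_z j) * T) $$ k"
      by (simp add: var_z_def left_diff_distrib)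
    with that show "T $$ k = 0 $$ k"
      by (simp add: mfps_var_diff_cancel)
  qed
  have prod: "T = 0" if "finite A" "\<And>k T. k \<in> A \<Longrightarrow> h k * T = 0 \<Longrightarrow> T = 0" "prod h A * T = 0"
    for A :: "nat set" and h and T :: "'a mfps fls"
    using that by (induction A arbitrary: T) (auto simp: mult.assoc)
  have den: "T = 0" if "denom_z n k * T = 0" for k and T :: "'a mfps fls"
    using that unfolding denom_z_def
  proof (rule prod[rotated 2])
    show "T' = 0" if "j \<in> {1..n} - {k}" "(var_z k - var_z j) * T' = 0" for j and T' :: "'a mfps fls"
      using that by (intro var[of k j T']) auto
  qed simp
  show ?thesis
    by (rule prod[OF _ den assms]) simp
qed

lemma is_fraction_sum_unique:
  assumes "is_fraction_sum n Q S" and "is_fraction_sum n Q T"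
  shows "S = T"
proof -
  have "(\<Prod>k\<in>{1..n}. denom_z n k) * (S - T) = 0"
  proof -
    have "S * (\<Prod>k\<in>{1..n}. denom_z n k) = T * (\<Prod>k\<in>{1..n}. denom_z n k)"
      using assms unfolding is_fraction_sum_def by (elim conjE) (rule trans, assumption, rule sym)
    thus ?thesis
      by (simp only: right_diff_distrib mult.commute[of "prod _ _"] diff_self)
  qed
  thus ?thesis
    using denom_z_prod_cancel[of n "S - T"] by simp
qed

definition fraction_sum :: "nat \<Rightarrow> 'a::comm_ring_1 fls fls \<Rightarrow> 'a mfps fls" where
  "fraction_sum n Q = (THE S. is_fraction_sum n Q S)"

definition fraction_sum_at ::
    "nat \<Rightarrow> 'a::comm_ring_1 fls fls \<Rightarrow> (nat \<Rightarrow> 'a fps) \<Rightarrow> 'a fls" where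
  "fraction_sum_at n Q u = fls_extend (mfps_subst n u) (fraction_sum n Q)"

end

theory Submission
  imports Defs "HOL-Computational_Algebra.Polynomial"
begin

text \<open>
  Since \<open>f(u)\<close> is the coefficient of \<open>x\<^sup>-\<^sup>1\<close> in \<open>f / (x - u)\<close>, the series \<open>\<partial>\<^sub>u f\<close> has no term in \<open>x\<^sup>-\<^sup>1\<close>;
  as \<open>(x - u) \<partial>\<^sub>u f = f - f(u)\<close> has no negative powers of \<open>x\<close>, neither does \<open>\<partial>\<^sub>u f\<close>. In
  \<open>f \<Prod>\<^sub>i 1 / (x - u\<^sub>i)\<close> one factor at a time is absorbed by \<open>f / (x - u) = \<partial>\<^sub>u f + f(u) / (x - u)\<close>,
  where the last summand contributes only negative powers of \<open>x\<close>.

  The expansion of \<open>\<Prod>\<^sub>i 1 / (x - u\<^sub>i)\<close> over the monomials \<open>u\<^sup>M\<close> in the \<open>u\<^sub>i\<close> shows that the constant part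
  is \<open>\<Sum>\<^sub>M Q\<^bsub>|M|+n-1\<^esub> u\<^sup>M\<close>, with \<open>Q\<^sub>m\<close> the coefficient of \<open>x\<^sup>m\<close> in \<open>Q\<close>. That \<open>\<Sum>\<^sub>M Q\<^bsub>|M|+n-1\<^esub> z\<^sup>M\<close> equals the sum
  of fractions follows by applying the formal residue of \<open>Q(x) p(x) \<Prod>\<^sub>i 1 / (x - z\<^sub>i)\<close>, which is
  linear in the polynomial \<open>p\<close>, to the Lagrange interpolation of the constant \<open>p = 1\<close>.
\<close>

section \<open>Expansion of the product of the \<open>1 / (x - u\<^sub>i)\<close>\<close>

definition monomials :: "nat set \<Rightarrow> nat \<Rightarrow> nat multiset set" where
  "monomials B d = {M. set_mset M \<subseteq> B \<and> size M \<le> d}"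

lemma finite_monomials_set [simp]: "finite B \<Longrightarrow> finite (monomials B d)"
  unfolding monomials_def by (rule finite_monomials)

text \<open>Splits by whether \<open>a\<close> occurs: removing one \<open>a\<close> lowers the
  degree bound by one. This is the recursion of the complete homogeneous polynomials.\<close>

lemma sum_monomials_insert:
  assumes "finite B" "a \<notin> B"
  shows "sum f (monomials (insert a B) (Suc d)) =
    sum f (monomials B (Suc d)) + (\<Sum>M\<in>monomials (insert a B) d. f (add_mset a M))"
proof -
  have split: "monomials (insert a B) (Suc d) =
      monomials B (Suc d) \<union> add_mset a ` monomials (insert a B) d" (is "?L = ?R")
  proof
    show "?L \<subseteq> ?R"
    proof
      fix M assume M: "M \<in> ?L"
      show "M \<in> ?R"
      proof (cases "a \<in># M")
        case True
        then obtain N where N: "M = add_mset a N" by (metis mset_add)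
        with M have "N \<in> monomials (insert a B) d"
          by (auto simp: monomials_def)
        with N show ?thesis by blast
      next
        case False
        with M show ?thesis by (auto simp: monomials_def)
      qed
    qed
    show "?R \<subseteq> ?L"
      by (auto simp: monomials_def)
  qed
  have disj: "monomials B (Suc d) \<inter> add_mset a ` monomials (insert a B) d = {}"
    using assms by (auto simp: monomials_def)
  have "inj_on (add_mset a) (monomials (insert a B) d)"
    by (auto intro: inj_onI)
  thus ?thesis
    unfolding split using assms
    by (subst sum.union_disjoint[OF _ _ disj]) (simp_all add: sum.reindex)
qed

text \<open>Every factor has order at least 1 in t, so the product has order at least
  \<open>size M\<close>.\<close>

lemma prod_mset_fps_nth_eq_0:
  fixes u :: "nat \<Rightarrow> 'a::comm_ring_1 fps"
  assumes "\<And>i. i \<in># M \<Longrightarrow> u i $ 0 = 0" "d < size M"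
  shows "(\<Prod>i\<in>#M. u i) $ d = 0"
  using assms
proof (induction M arbitrary: d)
  case (add a M)
  have "u a $ i * (\<Prod>i\<in>#M. u i) $ (d - i) = 0" if "i \<le> d" for i
  proof (cases "i = 0")
    case False
    with add.prems that have "(\<Prod>i\<in>#M. u i) $ (d - i) = 0"
      by (intro add.IH) auto
    thus ?thesis by simp
  qed (use add.prems in simp)
  thus ?case
    by (simp add: fps_mult_nth)
qed simp

lemma fls_const_sum: "fls_const (sum f A) = (\<Sum>i\<in>A. fls_const (f i))"
  by (rule fls_eqI) (simp add: fls_nth_sum)

lemma fls_const_prod: "fls_const (prod f A) = (\<Prod>i\<in>A. fls_const (f i))"
  by (induction A rule: infinite_finite_induct) (simp_all flip: fls_const_mult_const)

text \<open>The product of the geometric series of \<open>1/(x - u_i)\<close> over \<open>B\<close>,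
  collected by monomials. For \<open>u_i\<close> without constant term the cut at size
  \<open>d\<close> loses nothing.\<close>

definition inv_expansion :: "nat set \<Rightarrow> (nat \<Rightarrow> 'a::comm_ring_1 fps) \<Rightarrow> 'a fls fps" where
  "inv_expansion B u = Abs_fps (\<lambda>d.
     \<Sum>M\<in>monomials B d. fls_const ((\<Prod>i\<in>#M. u i) $ d) * fls_X_inv ^ (card B + size M))"

lemma inv_expansion_empty: "inv_expansion {} u = 1"
proof (rule fps_ext)
  fix d
  have "monomials {} d = {{#}}"
    by (auto simp: monomials_def)
  thus "inv_expansion {} u $ d = 1 $ d"
    by (simp add: inv_expansion_def)
qed

lemma inv_expansion_nth:
  fixes u :: "nat \<Rightarrow> 'a::comm_ring_1 fps"
  assumes "finite B" "\<And>i. i \<in> B \<Longrightarrow> u i $ 0 = 0" "d \<le> N"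
  shows "inv_expansion B u $ d =
    (\<Sum>M\<in>monomials B N. fls_const ((\<Prod>i\<in>#M. u i) $ d) * fls_X_inv ^ (card B + size M))"
  unfolding inv_expansion_def fps_nth_Abs_fps
proof (rule sum.mono_neutral_left)
  show "\<forall>M\<in>monomials B N - monomials B d.
      fls_const ((\<Prod>i\<in>#M. u i) $ d) * fls_X_inv ^ (card B + size M) = 0"
  proof
    fix M assume "M \<in> monomials B N - monomials B d"
    hence "(\<Prod>i\<in>#M. u i) $ d = 0"
      using assms(2) by (intro prod_mset_fps_nth_eq_0) (auto simp: monomials_def)
    thus "fls_const ((\<Prod>i\<in>#M. u i) $ d) * fls_X_inv ^ (card B + size M) = 0" by simp
  qed
qed (use assms in \<open>auto simp: monomials_def finite_monomials\<close>)

text \<open>With H and G the expansions for \<open>insert a B\<close> and \<open>B\<close>, this is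
  \<open>(x - u_a) H = G\<close> in the form \<open>H = x^-1 (G + u_a H)\<close>.\<close>

lemma inv_expansion_insert:
  fixes u :: "nat \<Rightarrow> 'a::comm_ring_1 fps"
  assumes B: "finite B" "a \<notin> B" and u: "\<And>i. i \<in> insert a B \<Longrightarrow> u i $ 0 = 0"
  shows "inv_expansion (insert a B) u = fps_const fls_X_inv *
    (inv_expansion B u + Abs_fps (\<lambda>j. fls_const (u a $ j)) * inv_expansion (insert a B) u)"
proof (rule fps_ext)
  fix d
  let ?p = "\<lambda>M. \<Prod>i\<in>#M. u i"
  \<comment> \<open>The bound is raised to \<open>Suc d\<close> so that it is still \<open>d\<close>
    after one \<open>a\<close> is split off.\<close>
  have "inv_expansion (insert a B) u $ d = (\<Sum>M\<in>monomials (insert a B) (Suc d).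
      fls_const (?p M $ d) * fls_X_inv ^ (card (insert a B) + size M))"
    using assms by (intro inv_expansion_nth) auto
  also have "\<dots> = fls_X_inv * (\<Sum>M\<in>monomials B (Suc d).
      fls_const (?p M $ d) * fls_X_inv ^ (card B + size M)) +
    fls_X_inv * (\<Sum>M\<in>monomials (insert a B) d. fls_const ((u a * ?p M) $ d) *
       fls_X_inv ^ (card (insert a B) + size M))"
    using B by (simp add: sum_monomials_insert sum_distrib_left mult_ac)
  also have "(\<Sum>M\<in>monomials B (Suc d). fls_const (?p M $ d) * fls_X_inv ^ (card B + size M)) =
      inv_expansion B u $ d"
    using assms by (intro inv_expansion_nth[symmetric]) auto
  also have "(\<Sum>M\<in>monomials (insert a B) d. fls_const ((u a * ?p M) $ d) *
       fls_X_inv ^ (card (insert a B) + size M)) =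
     (\<Sum>i=0..d. fls_const (u a $ i) * (\<Sum>M\<in>monomials (insert a B) d.
        fls_const (?p M $ (d - i)) * fls_X_inv ^ (card (insert a B) + size M)))"
    unfolding fps_mult_nth fls_const_sum sum_distrib_right sum_distrib_left
    by (subst sum.swap) (simp add: mult.assoc flip: fls_const_mult_const)
  also have "\<dots> = (\<Sum>i=0..d. fls_const (u a $ i) * inv_expansion (insert a B) u $ (d - i))"
    using assms by (intro sum.cong refl arg_cong2[where f = "(*)"] inv_expansion_nth[symmetric]) auto
  finally show "inv_expansion (insert a B) u $ d = (fps_const fls_X_inv * (inv_expansion B u +
      Abs_fps (\<lambda>j. fls_const (u a $ j)) * inv_expansion (insert a B) u)) $ d"
    by (simp only: fps_mult_left_const_nth fps_add_nth fps_mult_nth[of "Abs_fps _"] fps_nth_Abs_fps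
        distrib_left)
qed

lemma prod_inv_x_minus:
  fixes u :: "nat \<Rightarrow> 'a::comm_ring_1 fps"
  assumes "finite B" "\<And>i. i \<in> B \<Longrightarrow> u i $ 0 = 0"
  shows "(\<Prod>i\<in>B. inv_x_minus (u i)) = fps_to_fls (inv_expansion B u)"
  using assms
proof (induction B)
  case empty
  show ?case by (simp add: inv_expansion_empty)
next
  case (insert a B)
  let ?U = "const_x (fps_to_fls (u a))"
  let ?G = "fps_to_fls (inv_expansion B u)" and ?H = "fps_to_fls (inv_expansion (insert a B) u)"
  have U: "?U = fps_to_fls (Abs_fps (\<lambda>j. fls_const (u a $ j)))"
    by (rule fls_eqI) (simp add: const_x_nth)
  have "?H = fls_const fls_X_inv * (?G + ?U * ?H)"
    by (subst inv_expansion_insert[OF insert.hyps insert.prems], assumption)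
       (simp only: U fls_times_fps_to_fls fps_to_fls_plus fps_const_to_fls)
  hence "var_x * ?H = var_x * fls_const fls_X_inv * (?G + ?U * ?H)"
    by (metis mult.assoc)
  also have "var_x * fls_const fls_X_inv = (1 :: 'a fls fls)"
    by (simp add: var_x_def fls_X_times_conv_shift)
  finally have G: "(var_x - ?U) * ?H = ?G"
    by (simp add: left_diff_distrib)
  have "inv_x_minus (u a) * ?G = ((var_x - ?U) * inv_x_minus (u a)) * ?H"
    by (simp only: G[symmetric] mult_ac)
  also have "\<dots> = ?H"
    by (simp only: x_minus_mult_inv[OF insert.prems[OF insertI1]] mult_1_left)
  finally show ?case
    using insert by simp
qed


section \<open>The positive part\<close>

text \<open>The range does not involve \<open>subdegree G\<close>, so the sum has the shape of
  \<open>fls_extend_nth\<close> and can be compared with it termwise.\<close>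

lemma fls_times_fps_to_fls_nth:
  fixes f :: "'b::comm_ring_1 fls"
  shows "(f * fps_to_fls G) $$ q = (\<Sum>k = fls_subdegree f..q. f $$ k * G $ nat (q - k))"
proof -
  have "(f * fps_to_fls G) $$ q =
      (\<Sum>k = fls_subdegree f..q - int (subdegree G). f $$ k * fps_to_fls G $$ (q - k))"
    by (simp only: fls_times_nth(2) fls_subdegree_fls_to_fps)
  also have "\<dots> = (\<Sum>k = fls_subdegree f..q. f $$ k * fps_to_fls G $$ (q - k))"
    by (rule sum.mono_neutral_left) (auto simp: nth_less_subdegree_zero)
  finally show ?thesis by simp
qed

lemma fls_times_const_X_inv_power_nth:
  fixes g :: "'a::comm_ring_1 fls"
  shows "(g * (fls_const c * fls_X_inv ^ e)) $$ m = c * g $$ (m + int e)"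
proof (induction e arbitrary: m)
  case (Suc e)
  have "g * (fls_const c * fls_X_inv ^ Suc e) = (g * (fls_const c * fls_X_inv ^ e)) * fls_X_inv"
    by (simp add: mult_ac)
  thus ?case
    using Suc[of "m + 1"] by (simp add: fls_X_inv_times_conv_shift(2) add.assoc)
qed (simp add: mult.commute)

lemma times_inv_expansion_nth:
  fixes f :: "'a::comm_ring_1 fls fls"
  shows "(f * fps_to_fls (inv_expansion B u)) $$ q $$ m =
    (\<Sum>k = fls_subdegree f..q. \<Sum>M\<in>monomials B (nat (q - k)).
       (\<Prod>i\<in>#M. u i) $ nat (q - k) * f $$ k $$ (m + int (card B + size M)))"
  by (simp only: fls_times_fps_to_fls_nth fls_nth_sum inv_expansion_def fps_nth_Abs_fps
      sum_distrib_left fls_times_const_X_inv_power_nth)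

lemma inv_expansion_nth_eq_0:
  fixes u :: "nat \<Rightarrow> 'a::comm_ring_1 fps"
  assumes "- int (card B) < m"
  shows "fps_to_fls (inv_expansion B u) $$ q $$ m = 0"
proof -
  have "fls_subdegree (1 :: 'a fls fls) = 0" by simp
  thus ?thesis
    using times_inv_expansion_nth[of 1 B u q m] assms
    by (simp only: mult_1_left) (auto intro!: sum.neutral)
qed

lemma const_x_times_nth_eq_0:
  fixes h :: "'a::comm_ring_1 fls fls"
  assumes "\<And>q. h $$ q $$ m = 0"
  shows "(const_x c * h) $$ q $$ m = 0"
  by (simp only: fls_times_nth(1)[of "const_x c" h] fls_nth_sum const_x_nth fls_mult_const_nth assms
      mult_zero_right sum.neutral_const)

lemma monomials_singleton:
  "monomials {a} d = (\<lambda>i. replicate_mset i a) ` {0..d}"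
proof
  show "monomials {a} d \<subseteq> (\<lambda>i. replicate_mset i a) ` {0..d}"
  proof
    fix M assume M: "M \<in> monomials {a} d"
    hence "M = replicate_mset (size M) a"
      unfolding monomials_def by (metis (mono_tags) mem_Collect_eq set_mset_subset_singletonD)
    with M show "M \<in> (\<lambda>i. replicate_mset i a) ` {0..d}"
      by (intro image_eqI[where x = "size M"]) (simp_all add: monomials_def)
  qed
  show "(\<lambda>i. replicate_mset i a) ` {0..d} \<subseteq> monomials {a} d"
    by (auto simp: monomials_def split: if_splits)
qed

lemma inj_on_replicate_mset: "inj_on (\<lambda>i. replicate_mset i a) A"
  by (rule inj_onI) (metis size_replicate_mset)

section \<open>Residues in x of quotients by \<open>x - u\<close>\<close>

lemma inv_x_minus_conv_expansion:
  assumes "u $ 0 = 0"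
  shows "inv_x_minus u = fps_to_fls (inv_expansion {0} (\<lambda>_. u))"
  using prod_inv_x_minus[of "{0}" "\<lambda>_. u"] assms by simp

text \<open>In \<open>f u^i x^(-1-i)\<close> the coefficient of \<open>x^-1\<close> is
  \<open>f_i u^i\<close>; summing over i gives \<open>f(u)\<close>.\<close>

lemma times_inv_x_minus_residue:
  fixes f :: "'a::comm_ring_1 fls fls"
  assumes "u $ 0 = 0"
  shows "(f * inv_x_minus u) $$ q $$ (-1) = eval_x f u $$ q"
  unfolding inv_x_minus_conv_expansion[OF assms] times_inv_expansion_nth eval_x_def fls_extend_nth
    fps_compose_nth monomials_singleton sum.reindex[OF inj_on_replicate_mset[of 0]]
  by (simp add: o_def mult.commute)

lemma const_x_times_inv_x_minus_residue:
  fixes c :: "'a::comm_ring_1 fls"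
  assumes "u $ 0 = 0"
  shows "(const_x c * inv_x_minus u) $$ q $$ (-1) = c $$ q"
proof -
  have "(const_x c * inv_x_minus u) $$ q $$ (-1) = (\<Sum>k = fls_subdegree (const_x c)..q.
      \<Sum>i = 0..nat (q - k). (u ^ i) $ nat (q - k) * fls_const (c $$ k) $$ int i)"
    unfolding inv_x_minus_conv_expansion[OF assms] times_inv_expansion_nth
      monomials_singleton sum.reindex[OF inj_on_replicate_mset[of 0]] by (simp add: const_x_nth)
  also have "\<dots> = (\<Sum>k = fls_subdegree (const_x c)..q. if k = q then c $$ q else 0)"
  proof (intro sum.cong refl)
    fix k assume "k \<in> {fls_subdegree (const_x c)..q}"
    have "(\<Sum>i = 0..nat (q - k). (u ^ i) $ nat (q - k) * fls_const (c $$ k) $$ int i) =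
        (\<Sum>i = 0..nat (q - k). if i = 0 then (u ^ 0) $ nat (q - k) * c $$ k else 0)"
      by (intro sum.cong) auto
    thus "(\<Sum>i = 0..nat (q - k). (u ^ i) $ nat (q - k) * fls_const (c $$ k) $$ int i) =
        (if k = q then c $$ q else 0)"
      using \<open>k \<in> _\<close> by simp
  qed
  also have "\<dots> = c $$ q"
  \<comment> \<open>Below the subdegree the sum is empty, but there \<open>c $$ q\<close> vanishes
    as well.\<close>
  proof (cases "q < fls_subdegree (const_x c)")
    case True
    hence "fls_const (c $$ q) = 0"
      by (simp flip: const_x_nth)
    with True show ?thesis by simp
  qed simp
  finally show ?thesis .
qed

lemma nonneg_divdiff:
  fixes f :: "'a::comm_ring_1 fls fls"
  assumes u: "u $ 0 = 0" and f: "nonneg_powers_x f"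
  shows "nonneg_powers_x (divdiff u f)"
proof -
  let ?h = "divdiff u f"
  have step: "?h $$ q $$ (m - 1) = (const_x (fps_to_fls u) * ?h) $$ q $$ m" if "m < 0" for q m
  proof -
    have "((var_x - const_x (fps_to_fls u)) * ?h) $$ q $$ m = 0"
      using that f by (simp add: x_minus_mult_divdiff[OF u] const_x_nth nonneg_powers_x_def)
    thus ?thesis
      by (simp add: left_diff_distrib var_x_def fls_X_times_conv_shift)
  qed
  \<comment> \<open>Descends from \<open>x^-1\<close>, where the residues of
    \<open>f / (x - u)\<close> and \<open>f(u) / (x - u)\<close> cancel. All \<open>q\<close> are
    treated at once because multiplication by u mixes the powers of t.\<close>
  have neg: "?h $$ q $$ (- int (Suc j)) = 0" for q j
  proof (induction j arbitrary: q)
    case 0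
    show ?case
      using times_inv_x_minus_residue[OF u, of f q]
        const_x_times_inv_x_minus_residue[OF u, of "eval_x f u" q]
      by (simp add: divdiff_def left_diff_distrib)
  next
    case (Suc j)
    have "?h $$ q $$ (- int (Suc j) - 1) = 0"
      by (subst step) (simp, rule const_x_times_nth_eq_0[OF Suc])
    thus ?case by simp
  qed
  show ?thesis
    unfolding nonneg_powers_x_def
  proof (intro allI impI)
    fix q m :: int assume "m < 0"
    then obtain j where "m = - int (Suc j)" using negD by blast
    thus "?h $$ q $$ m = 0" by (simp only: neg)
  qed
qed

lemma PT_eq_self: "nonneg_powers_x f \<Longrightarrow> PT f = f"
  by (intro fls_eqI) (auto simp: PT_nth nonneg_powers_x_def)

lemma PT_add: "PT (f + g) = PT f + PT g"
  by (intro fls_eqI) (simp add: PT_nth)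

lemma PT_times_prod_inv_x_minus:
  fixes u :: "nat \<Rightarrow> 'a::comm_ring_1 fps"
  assumes "distinct is" "\<And>i. i \<in> set is \<Longrightarrow> u i $ 0 = 0" "nonneg_powers_x Q"
  shows "PT (Q * (\<Prod>i\<in>set is. inv_x_minus (u i))) = fold (\<lambda>i. divdiff (u i)) is Q"
  using assms
proof (induction "is" arbitrary: Q)
  case Nil
  thus ?case by (simp add: PT_eq_self)
next
  case (Cons a "is")
  let ?c = "const_x (eval_x Q (u a))"
  let ?P = "\<Prod>i\<in>set is. inv_x_minus (u i)" and ?P' = "\<Prod>i\<in>set (a # is). inv_x_minus (u i)"
  have "PT (?c * ?P') = 0"
  proof (intro fls_eqI)
    fix q m
    have "(?c * ?P') $$ q $$ m = 0" if "0 \<le> m"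
    proof (rule const_x_times_nth_eq_0)
      \<comment> \<open>The factor for \<open>a\<close> is still present, so all powers of x in
        \<open>?P'\<close> are negative.\<close>
      have "card (set (a # is)) > 0" by (simp only: card_gt_0_iff) simp
      moreover have "?P' = fps_to_fls (inv_expansion (set (a # is)) u)"
        using Cons.prems(2) by (intro prod_inv_x_minus) simp_all
      ultimately show "?P' $$ q' $$ m = 0" for q'
        using that by (simp only:) (rule inv_expansion_nth_eq_0, linarith)
    qed
    thus "PT (?c * ?P') $$ q $$ m = 0 $$ q $$ m" by (simp add: PT_nth)
  qed
  moreover have "Q * ?P' = divdiff (u a) Q * ?P + ?c * ?P'"
    using Cons.prems(1) by (simp add: divdiff_def algebra_simps)
  ultimately have "PT (Q * ?P') = PT (divdiff (u a) Q * ?P)"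
    by (simp only: PT_add add_0_right)
  also have "\<dots> = fold (\<lambda>i. divdiff (u i)) is (divdiff (u a) Q)"
    using Cons.prems by (intro Cons.IH nonneg_divdiff) auto
  finally show ?case by simp
qed


section \<open>Partial fractions\<close>

lemma degree_linear_times:
  fixes p :: "'b::comm_ring_1 poly"
  assumes "p \<noteq> 0"
  shows "degree ([:- a, 1:] * p) = Suc (degree p)"
proof (rule antisym)
  show "degree ([:- a, 1:] * p) \<le> Suc (degree p)"
    using degree_mult_le[of "[:- a, 1:]" p] by simp
  have "coeff ([:- a, 1:] * p) (Suc (degree p)) = lead_coeff p"
    by (simp add: coeff_eq_0)
  with assms show "Suc (degree p) \<le> degree ([:- a, 1:] * p)"
    by (intro le_degree) simp
qed

text \<open>With zero divisors, counting roots needs cancellable differences: these pass the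
  remaining roots on to the quotient by \<open>x - z_a\<close>. The case \<open>p = 0\<close> in the
  degree condition lets the induction reach empty \<open>A\<close>.\<close>

lemma poly_eq_0_of_cancellable_roots:
  fixes p :: "'b::comm_ring_1 poly"
  assumes "finite A" "p = 0 \<or> degree p < card A"
    and "\<And>i. i \<in> A \<Longrightarrow> poly p (z i) = 0"
    and "\<And>i j y. i \<in> A \<Longrightarrow> j \<in> A \<Longrightarrow> i \<noteq> j \<Longrightarrow> (z i - z j) * y = 0 \<Longrightarrow> y = 0"
  shows "p = 0"
  using assms
proof (induction A arbitrary: p)
  case (insert a A)
  from insert.prems(2)[of a] obtain q where p: "p = [:- z a, 1:] * q"
    by (auto simp: poly_eq_0_iff_dvd elim: dvdE)
  have "q = 0"
  proof (rule insert.IH)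
    show "q = 0 \<or> degree q < card A"
      using insert.prems(1) insert.hyps degree_linear_times[of q "z a"]
      by (cases "q = 0") (auto simp: p)
    show "poly q (z i) = 0" if "i \<in> A" for i
    proof (rule insert.prems(3))
      show "(z i - z a) * poly q (z i) = 0"
        using insert.prems(2)[of i] that by (simp add: p algebra_simps)
    qed (use that insert.hyps in auto)
  qed (use insert.prems(3) in blast)
  thus ?case by (simp add: p)
qed simp

text \<open>
  Partial fraction decomposition of \<open>\<Prod>\<^sub>i 1 / (x - z\<^sub>i)\<close>, multiplied out so as to be meaningful in
  any commutative ring; it is the Lagrange interpolation of the constant \<open>1\<close>.
\<close>

lemma partial_fractions_one:
  fixes z :: "nat \<Rightarrow> 'b::comm_ring_1"
  assumes "finite A" "A \<noteq> {}"
    and "\<And>i j y. i \<in> A \<Longrightarrow> j \<in> A \<Longrightarrow> i \<noteq> j \<Longrightarrow> (z i - z j) * y = 0 \<Longrightarrow> y = 0"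
  defines "D \<equiv> \<lambda>i. \<Prod>j\<in>A - {i}. z i - z j"
  shows "(\<Sum>i\<in>A. smult (\<Prod>k\<in>A - {i}. D k) (\<Prod>j\<in>A - {i}. [:- z j, 1:])) = [:\<Prod>k\<in>A. D k:]"
proof -
  let ?p = "\<lambda>i. smult (\<Prod>k\<in>A - {i}. D k) (\<Prod>j\<in>A - {i}. [:- z j, 1:])"
  have card: "card A > 0" using assms(1,2) by (simp add: card_gt_0_iff)
  have "(\<Sum>i\<in>A. ?p i) - [:\<Prod>k\<in>A. D k:] = 0"
  proof (rule poly_eq_0_of_cancellable_roots[OF assms(1) disjI2 _ assms(3)])
    have "degree (?p i) \<le> card A - 1" if "i \<in> A" for i
    proof -
      have "degree (?p i) \<le> degree (\<Prod>j\<in>A - {i}. [:- z j, 1:])"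
        by (rule degree_smult_le)
      also have "\<dots> \<le> (\<Sum>j\<in>A - {i}. (degree \<circ> (\<lambda>j. [:- z j, 1:])) j)"
        using assms(1) by (intro degree_prod_sum_le) simp
      also have "\<dots> = card A - 1"
        using that assms(1) by simp
      finally show ?thesis .
    qed
    hence "degree ((\<Sum>i\<in>A. ?p i) - [:\<Prod>k\<in>A. D k:]) \<le> card A - 1"
      using assms(1) by (intro degree_diff_le degree_sum_le) simp_all
    with card show "degree ((\<Sum>i\<in>A. ?p i) - [:\<Prod>k\<in>A. D k:]) < card A"
      by linarith
    show "poly ((\<Sum>i\<in>A. ?p i) - [:\<Prod>k\<in>A. D k:]) (z l) = 0" if l: "l \<in> A" for l
    proof -
      \<comment> \<open>At \<open>z l\<close> only summand \<open>l\<close> survives, and its linear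
        factors supply the missing \<open>D l\<close>.\<close>
      have "poly (?p i) (z l) = (if i = l then \<Prod>k\<in>A. D k else 0)" if "i \<in> A" for i
      proof (cases "i = l")
        case True
        thus ?thesis
          using l assms(1) by (simp add: poly_prod D_def prod.remove[of A l] mult.commute)
      next
        case False
        hence "(\<Prod>j\<in>A - {i}. z l - z j) = 0"
          using l assms(1) by (intro prod_zero) auto
        with False show ?thesis by (simp add: poly_prod)
      qed
      thus ?thesis
        using l assms(1) by (simp add: poly_sum)
    qed
  qed
  thus ?thesis by simp
qed

text \<open>
  This is \<open>\<Sum>\<^sub>m g\<^sub>m h\<^bsub>m - c\<^esub>(z\<^sub>B)\<close>, with \<open>h\<close> the complete homogeneous
  symmetric polynomials.
\<close>

lift_definition homogeneous_sum :: "'a::comm_ring_1 fls \<Rightarrow> nat set \<Rightarrow> int \<Rightarrow> 'a mfps" is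
  "\<lambda>g B c M. if set_mset M \<subseteq> B then g $$ (int (size M) + c) else 0" .

text \<open>Monomials containing \<open>a\<close> cancel: taking out one \<open>a\<close> lowers the
  size by one, which the shift \<open>c + 1\<close> makes up for.\<close>

lemma homogeneous_sum_insert:
  assumes "a \<notin> B"
  shows "homogeneous_sum g (insert a B) c - mfps_var a * homogeneous_sum g (insert a B) (c + 1) =
    homogeneous_sum g B c"
proof (rule mfps_eqI)
  fix M
  show "mfps_nth (homogeneous_sum g (insert a B) c -
        mfps_var a * homogeneous_sum g (insert a B) (c + 1)) M =
      mfps_nth (homogeneous_sum g B c) M"
  proof (cases "a \<in># M")
    case True
    then obtain N where "M = add_mset a N" by (metis mset_add)
    with assms show ?thesis
      by (auto simp: minus_mfps.rep_eq mfps_var_times_nth homogeneous_sum.rep_eq algebra_simps)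
  next
    case False
    thus ?thesis
      by (auto simp: minus_mfps.rep_eq mfps_var_times_nth homogeneous_sum.rep_eq)
  qed
qed

text \<open>Formally the residue at \<open>x = 0\<close> of \<open>g(x) p(x) \<Prod>\<^bsub>i\<in>B\<^esub> 1 / (x - z\<^sub>i)\<close>.\<close>

definition residue_z :: "'a::comm_ring_1 fls \<Rightarrow> nat set \<Rightarrow> 'a mfps poly \<Rightarrow> 'a mfps" where
  "residue_z g B p = (\<Sum>k\<le>degree p. coeff p k * homogeneous_sum g B (int (card B) - 1 - int k))"

lemma residue_z_alt:
  assumes "degree p \<le> N"
  shows "residue_z g B p = (\<Sum>k\<le>N. coeff p k * homogeneous_sum g B (int (card B) - 1 - int k))"
  unfolding residue_z_def
  by (rule sum.mono_neutral_left) (use assms in \<open>auto simp: coeff_eq_0\<close>)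

lemma residue_z_add: "residue_z g B (p + q) = residue_z g B p + residue_z g B q"
proof -
  have "degree (p + q) \<le> max (degree p) (degree q)"
    by (rule degree_add_le_max)
  thus ?thesis
    by (simp add: residue_z_alt[where N = "max (degree p) (degree q)"] distrib_right sum.distrib)
qed

lemma residue_z_0 [simp]: "residue_z g B 0 = 0"
  by (simp add: residue_z_def)

lemma residue_z_smult: "residue_z g B (smult c p) = c * residue_z g B p"
  unfolding residue_z_alt[OF degree_smult_le[of c p]] residue_z_def[of g B p]
  by (simp add: sum_distrib_left mult.assoc)

lemma residue_z_sum: "residue_z g B (sum p A) = (\<Sum>i\<in>A. residue_z g B (p i))"
  by (induction A rule: infinite_finite_induct) (simp_all add: residue_z_add)

lemma residue_z_const: "residue_z g B [:c:] = c * homogeneous_sum g B (int (card B) - 1)"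
  by (simp add: residue_z_def)

text \<open>The factor \<open>x - z_a\<close> cancels \<open>1/(x - z_a)\<close> in the formal
  residue.\<close>

lemma residue_z_linear_times:
  assumes "finite B" "a \<notin> B"
  shows "residue_z g (insert a B) ([:- mfps_var a, 1:] * p) = residue_z g B p"
proof -
  \<comment> \<open>The offset is \<open>card B\<close> because it equals
    \<open>card (insert a B) - 1\<close>.\<close>
  let ?N = "degree p" and ?h = "\<lambda>k. homogeneous_sum g (insert a B) (int (card B) - int k)"
  have "degree ([:- mfps_var a, 1:] * p) \<le> Suc ?N"
    using degree_mult_le[of "[:- mfps_var a, 1:]" p] by simp
  hence "residue_z g (insert a B) ([:- mfps_var a, 1:] * p) =
      (\<Sum>k\<le>Suc ?N. coeff ([:- mfps_var a, 1:] * p) k * ?h k)"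
    using assms by (simp add: residue_z_alt)
  also have "\<dots> = (\<Sum>k\<le>Suc ?N. coeff (pCons 0 p) k * ?h k) -
      (\<Sum>k\<le>Suc ?N. mfps_var a * coeff p k * ?h k)"
    by (simp add: left_diff_distrib flip: sum_subtractf)
  also have "(\<Sum>k\<le>Suc ?N. coeff (pCons 0 p) k * ?h k) = (\<Sum>k\<le>?N. coeff p k * ?h (Suc k))"
    by (simp add: sum.atMost_Suc_shift del: sum.atMost_Suc)
  also have "(\<Sum>k\<le>Suc ?N. mfps_var a * coeff p k * ?h k) =
      (\<Sum>k\<le>?N. coeff p k * (mfps_var a * ?h k))"
    by (simp add: coeff_eq_0 mult_ac)
  also have "(\<Sum>k\<le>?N. coeff p k * ?h (Suc k)) - \<dots> =
      (\<Sum>k\<le>?N. coeff p k * (?h (Suc k) - mfps_var a * ?h k))"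
    by (simp add: right_diff_distrib sum_subtractf)
  also have "\<dots> = residue_z g B p"
    unfolding residue_z_def
  proof (intro sum.cong refl arg_cong2[where f = "(*)"])
    fix k
    show "?h (Suc k) - mfps_var a * ?h k = homogeneous_sum g B (int (card B) - 1 - int k)"
      using homogeneous_sum_insert[OF assms(2), of g "int (card B) - 1 - int k"]
      by (simp add: algebra_simps)
  qed
  finally show ?thesis .
qed

lemma residue_z_prod_linear:
  assumes "finite C" "finite B" "B \<inter> C = {}"
  shows "residue_z g (B \<union> C) (\<Prod>j\<in>C. [:- mfps_var j, 1:]) =
    homogeneous_sum g B (int (card B) - 1)"
  using assms
proof (induction C)
  case empty
  show ?case using residue_z_const[of g B 1] by (simp add: one_pCons)
next
  case (insert a C)
  thus ?case
    by (simp add: residue_z_linear_times del: mult_pCons_left)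
qed

lemma homogeneous_sum_singleton:
  "homogeneous_sum g {i} 0 = mfps_of_fps i (fls_regpart g)"
proof (rule mfps_eqI)
  fix M
  have "set_mset M \<subseteq> {i} \<longleftrightarrow> M = replicate_mset (size M) i"
    by (metis set_mset_subset_singletonD size_replicate_mset set_mset_replicate_mset_subset
        empty_subsetI order_refl)
  thus "mfps_nth (homogeneous_sum g {i} 0) M = mfps_nth (mfps_of_fps i (fls_regpart g)) M"
    by (simp add: homogeneous_sum.rep_eq mfps_of_fps.rep_eq)
qed

lemma homogeneous_sum_fractions:
  fixes g :: "'a::comm_ring_1 fls"
  assumes "finite A" "A \<noteq> {}"
  defines "D \<equiv> \<lambda>i. \<Prod>j\<in>A - {i}. mfps_var i - mfps_var j"
  shows "homogeneous_sum g A (int (card A) - 1) * (\<Prod>k\<in>A. D k) =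
    (\<Sum>i\<in>A. mfps_of_fps i (fls_regpart g) * (\<Prod>k\<in>A - {i}. D k))"
proof -
  have "homogeneous_sum g A (int (card A) - 1) * (\<Prod>k\<in>A. D k) = residue_z g A [:\<Prod>k\<in>A. D k:]"
    by (simp add: residue_z_const mult.commute)
  also have "[:\<Prod>k\<in>A. D k:] =
      (\<Sum>i\<in>A. smult (\<Prod>k\<in>A - {i}. D k) (\<Prod>j\<in>A - {i}. [:- mfps_var j, 1:]))"
    unfolding D_def
    by (rule partial_fractions_one[symmetric]) (use assms mfps_var_diff_cancel in blast)+
  also have "residue_z g A \<dots> =
      (\<Sum>i\<in>A. (\<Prod>k\<in>A - {i}. D k) * residue_z g A (\<Prod>j\<in>A - {i}. [:- mfps_var j, 1:]))"
    by (simp only: residue_z_sum residue_z_smult)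
  also have "\<dots> = (\<Sum>i\<in>A. mfps_of_fps i (fls_regpart g) * (\<Prod>k\<in>A - {i}. D k))"
  proof (intro sum.cong refl)
    fix i assume "i \<in> A"
    \<comment> \<open>Only \<open>1/(x - z_i)\<close> is left uncancelled, and its residue is
      \<open>g(z_i)\<close>.\<close>
    hence "residue_z g A (\<Prod>j\<in>A - {i}. [:- mfps_var j, 1:]) = mfps_of_fps i (fls_regpart g)"
      using residue_z_prod_linear[of "A - {i}" "{i}" g] assms(1)
      by (simp add: homogeneous_sum_singleton insert_absorb)
    thus "(\<Prod>k\<in>A - {i}. D k) * residue_z g A (\<Prod>j\<in>A - {i}. [:- mfps_var j, 1:]) =
        mfps_of_fps i (fls_regpart g) * (\<Prod>k\<in>A - {i}. D k)"
      by (simp only: mult.commute)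
  qed
  finally show ?thesis .
qed


section \<open>The constant part\<close>

lemma homogeneous_sum_0 [simp]: "homogeneous_sum 0 B c = 0"
  by (rule mfps_eqI) (simp add: homogeneous_sum.rep_eq zero_mfps.rep_eq)

lemma mfps_of_fps_0 [simp]: "mfps_of_fps i 0 = 0"
  by (rule mfps_eqI) (simp add: mfps_of_fps.rep_eq zero_mfps.rep_eq)

text \<open>The denominators are constant in t, so the defining identity can be checked at each
  power of t separately.\<close>

lemma fraction_sum_eq:
  assumes "n \<ge> 1"
  shows "fraction_sum n Q = fls_map (\<lambda>g. homogeneous_sum g {1..n} (int n - 1)) Q" (is "_ = ?S")
proof -
  define D :: "nat \<Rightarrow> 'a mfps" where "D i = (\<Prod>j\<in>{1..n} - {i}. mfps_var i - mfps_var j)" for i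
  have D: "denom_z n i = fls_const (D i)" for i
    by (simp add: denom_z_def D_def var_z_def fls_const_prod fls_minus_const)
  have "is_fraction_sum n Q ?S"
    unfolding is_fraction_sum_def
  proof (intro conjI allI impI)
    show "mfps_nth (?S $$ k) M = 0" if "\<not> set_mset M \<subseteq> {1..n}" for k M
      using that by (simp add: homogeneous_sum.rep_eq)
    show "?S * (\<Prod>k\<in>{1..n}. denom_z n k) =
        (\<Sum>i\<in>{1..n}. at_z Q i * (\<Prod>k\<in>{1..n} - {i}. denom_z n k))"
    proof (rule fls_eqI)
      fix q
      show "(?S * (\<Prod>k\<in>{1..n}. denom_z n k)) $$ q =
          (\<Sum>i\<in>{1..n}. at_z Q i * (\<Prod>k\<in>{1..n} - {i}. denom_z n k)) $$ q"
        using homogeneous_sum_fractions[of "{1..n}" "Q $$ q"] assms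
        unfolding D_def[symmetric] by (simp add: D at_z_def fls_nth_sum flip: fls_const_prod)
    qed
  qed
  thus ?thesis
    unfolding fraction_sum_def by (blast intro: is_fraction_sum_unique)
qed

text \<open>Passing from \<open>Q\<close> to its fraction sum may raise the subdegree, so the sum is
  allowed to start at any lower bound.\<close>

lemma fls_extend_nth_lower:
  assumes "h 0 = 0" "\<And>k. k < N \<Longrightarrow> f $$ k = 0"
  shows "fls_extend h f $$ q = (\<Sum>k = N..q. h (f $$ k) $ nat (q - k))"
proof (cases "f = 0")
  case True
  thus ?thesis using assms(1) by (simp add: fls_extend_nth)
next
  case False
  hence "N \<le> fls_subdegree f"
    using assms(2) by (rule fls_subdegree_geI)
  thus ?thesis
    unfolding fls_extend_nth using assms(1)
    by (intro sum.mono_neutral_left) auto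
qed

text \<open>Both sides expand to the same sum over monomials; the factor
  \<open>x^(-n - size M)\<close> makes \<open>x^-1\<close> pick out the power
  \<open>size M + n - 1\<close> of \<open>Q\<close>.\<close>

lemma fraction_sum_at_nth:
  fixes u :: "nat \<Rightarrow> 'a::comm_ring_1 fps"
  assumes "n \<ge> 1" "\<And>i. i \<in> {1..n} \<Longrightarrow> u i $ 0 = 0"
  shows "fraction_sum_at n Q u $$ q = (Q * (\<Prod>i\<in>{1..n}. inv_x_minus (u i))) $$ q $$ (-1)"
proof -
  have "fraction_sum_at n Q u $$ q = (\<Sum>k = fls_subdegree Q..q.
      mfps_subst n u (homogeneous_sum (Q $$ k) {1..n} (int n - 1)) $ nat (q - k))"
    unfolding fraction_sum_at_def fraction_sum_eq[OF assms(1)]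
    by (subst fls_extend_nth_lower[where N = "fls_subdegree Q"])
       (simp_all add: mfps_subst_def zero_mfps.rep_eq fps_zero_def)
  also have "\<dots> = (\<Sum>k = fls_subdegree Q..q. \<Sum>M\<in>monomials {1..n} (nat (q - k)).
      (\<Prod>i\<in>#M. u i) $ nat (q - k) * Q $$ k $$ (-1 + int (n + size M)))"
    by (intro sum.cong refl)
       (auto simp: mfps_subst_def monomials_def homogeneous_sum.rep_eq algebra_simps intro!: sum.cong)
  also have "\<dots> = (Q * (\<Prod>i\<in>{1..n}. inv_x_minus (u i))) $$ q $$ (-1)"
    using assms(2)
    by (simp only: prod_inv_x_minus finite_atLeastAtMost times_inv_expansion_nth card_atLeastAtMost
        diff_Suc_1)
  finally show ?thesis .
qed

theorem mainTheorem3: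
  fixes n :: nat and u :: "nat \<Rightarrow> 'a::comm_ring_1 fps" and Q :: "'a fls fls"
  assumes "n \<ge> 1"
    and "\<forall>i\<in>{1..n}. fps_nth (u i) 0 = 0"
    and "nonneg_powers_x Q"
  shows "PT (Q * (\<Prod>i\<in>{1..n}. inv_x_minus (u i)))
           = fold (\<lambda>i. divdiff (u i)) [1..<Suc n] Q
       \<and> CT (var_x * Q * (\<Prod>i\<in>{1..n}. inv_x_minus (u i)))
           = const_x (fraction_sum_at n Q u)"
proof
  have set: "set [1..<Suc n] = {1..n}" by auto
  show "PT (Q * (\<Prod>i\<in>{1..n}. inv_x_minus (u i))) = fold (\<lambda>i. divdiff (u i)) [1..<Suc n] Q"
    using PT_times_prod_inv_x_minus[of "[1..<Suc n]" u Q] assms by (simp only: set distinct_upt)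
  show "CT (var_x * Q * (\<Prod>i\<in>{1..n}. inv_x_minus (u i))) = const_x (fraction_sum_at n Q u)"
  proof (intro fls_eqI)
    fix q m
    let ?P = "\<Prod>i\<in>{1..n}. inv_x_minus (u i)"
    \<comment> \<open>The factor x turns the constant term into the residue.\<close>
    have "(var_x * (Q * ?P)) $$ q $$ 0 = (Q * ?P) $$ q $$ (-1)"
      by (simp only: var_x_def fls_mult_const_nth fls_X_times_conv_shift) simp
    moreover have "fraction_sum_at n Q u $$ q = (Q * ?P) $$ q $$ (-1)"
      using assms by (intro fraction_sum_at_nth) blast+
    ultimately show "CT (var_x * Q * ?P) $$ q $$ m = const_x (fraction_sum_at n Q u) $$ q $$ m"
      by (simp only: CT_nth const_x_nth mult.assoc fls_const_nth)
  qed
qed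

end
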